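(* Let $V$ be a proper total valuation ring of a division ring $K$, let $\sigma$ be an automorphism of $V$ (extended to $K$), and let $W$ be a proper overring of $V$ in $K$ (that is, $V\subsetneq W\subseteq K$) with $\sigma(W)=W$. Then the following three statements are equivalent: (1) $V+W[x,\sigma]x$ is a $\nu$-Bezout order in $K(x,\sigma)$; (2) $W=K$; (3) $V+W[x,\sigma]x$ is a Bezout order in $K(x,\sigma)$.
   Context: A total valuation ring of a division ring $K$ is a subring $V$ such that $a\in V$ or $a^{-1}\in V$ for every nonzero $a\in K$; it is proper if $V\neq K$. An automorphism $\sigma$ of $V$ extends uniquely to an automorphism of $K$, again denoted $\sigma$. $W[x,\sigma]$ is the Ore extension (skew polynomial ring) with coefficients in $W$ and multiplication $xa=\sigma(a)x$; $K(x,\sigma)$ is the quotient division ring of $K[x,\sigma]$. $V+W[x,\sigma]x$ is the subring of $W[x,\sigma]$ of skew polynomials with constant term in $V$. An order $S$ in a simple Artinian ring $Q$ is a prime Goldie ring with total quotient ring $Q$. For $A,B\subseteq Q$ put $(A:B)_l=\{q\in Q: qB\subseteq A\}$ and $(A:B)_r=\{q\in Q: Bq\subseteq A\}$. A right $S$-ideal is a right $S$-submodule $I$ of $Q$ containing a regular element of $S$ and with $uI\subseteq S$ for some unit $u$ of $Q$; it is integral if $I\subseteq S$. For a right $S$-ideal $I$ put $I_{\nu}=(S:(S:I)_l)_r$; symmetrically for a left $S$-ideal $J$ put ${}_{\nu}J=(S:(S:J)_r)_l$. $S$ is right $\nu$-Bezout if $I_{\nu}$ is a principal right ideal for every finitely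 generated integral right $S$-ideal $I$; left $\nu$-Bezout is defined symmetrically; $\nu$-Bezout means both. $S$ is a Bezout order if every finitely generated right ideal and every finitely generated left ideal of $S$ containing a regular element is principal. *)

theory Defs
  imports Complex_Main "HOL-Computational_Algebra.Polynomial"
begin

text \<open>
  The ambient rings \<open>K\<close> and \<open>Q\<close> are types; their subrings are sets. No commutativity is assumed.
\<close>

definition is_subring :: "'a::ring_1 set \<Rightarrow> bool" where
  "is_subring S \<longleftrightarrow> 1 \<in> S \<and> (\<forall>a\<in>S. \<forall>b\<in>S. a - b \<in> S \<and> a * b \<in> S)"

definition total_valuation_ring :: "'a::division_ring set \<Rightarrow> bool" where
  "total_valuation_ring V \<longleftrightarrow> is_subring V \<and> (\<forall>a. a \<noteq> 0 \<longrightarrow> a \<in> V \<or> inverse a \<in> V)"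

definition ring_automorphism_on :: "'a::ring_1 set \<Rightarrow> ('a \<Rightarrow> 'a) \<Rightarrow> bool" where
  "ring_automorphism_on S \<sigma> \<longleftrightarrow> bij_betw \<sigma> S S \<and> \<sigma> 1 = 1 \<and>
     (\<forall>a\<in>S. \<forall>b\<in>S. \<sigma> (a + b) = \<sigma> a + \<sigma> b \<and> \<sigma> (a * b) = \<sigma> a * \<sigma> b)"


subsection \<open>Skew polynomials\<close>

text \<open>
  \<open>K[x,\<sigma>]\<close> is the additive group \<^typ>\<open>'a poly\<close>, where \<open>p\<close> stands for
  \<open>\<Sum>\<^sub>i a\<^sub>i x\<^sup>i\<close> with the coefficients \<open>a\<^sub>i = coeff p i\<close> written on the left, with the product
  determined by \<open>(a x\<^sup>i) (b x\<^sup>j) = a \<sigma>\<^sup>i(b) x\<^sup>i\<^sup>+\<^sup>j\<close>, i.e. by \<open>x a = \<sigma>(a) x\<close>.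
\<close>

definition skew_times :: "('a::division_ring \<Rightarrow> 'a) \<Rightarrow> 'a poly \<Rightarrow> 'a poly \<Rightarrow> 'a poly" where
  "skew_times \<sigma> p q =
     (\<Sum>i\<le>degree p. \<Sum>j\<le>degree q. monom (coeff p i * (\<sigma> ^^ i) (coeff q j)) (i + j))"

definition skew_polys :: "'a::division_ring set \<Rightarrow> 'a poly set" where
  "skew_polys W = {p. \<forall>i. coeff p i \<in> W}"

text \<open>The set \<open>V + W[x,\<sigma>]x\<close>.\<close>

definition skew_polys_const_in :: "'a::division_ring set \<Rightarrow> 'a set \<Rightarrow> 'a poly set" where
  "skew_polys_const_in V W = {p \<in> skew_polys W. coeff p 0 \<in> V}"


subsection \<open>Orders\<close>

definition unit_elem :: "'q::ring_1 \<Rightarrow> bool" where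
  "unit_elem u \<longleftrightarrow> (\<exists>v. u * v = 1 \<and> v * u = 1)"

definition regular_in :: "'q::ring_1 set \<Rightarrow> 'q \<Rightarrow> bool" where
  "regular_in S c \<longleftrightarrow> c \<in> S \<and> (\<forall>s\<in>S. c * s = 0 \<longrightarrow> s = 0) \<and> (\<forall>s\<in>S. s * c = 0 \<longrightarrow> s = 0)"

text \<open>
  The whole type \<open>'q\<close> is the (two-sided) total quotient ring of \<open>S\<close>: regular elements become
  units, and every \<open>q\<close> has the form \<open>a c\<^sup>-\<^sup>1\<close> as well as \<open>d\<^sup>-\<^sup>1 b\<close>.
\<close>

definition has_total_quotient_ring_UNIV :: "'q::ring_1 set \<Rightarrow> bool" where
  "has_total_quotient_ring_UNIV S \<longleftrightarrow> is_subring S \<and>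
     (\<forall>c. regular_in S c \<longrightarrow> unit_elem c) \<and>
     (\<forall>q. \<exists>a\<in>S. \<exists>c. regular_in S c \<and> q * c = a) \<and>
     (\<forall>q. \<exists>b\<in>S. \<exists>d. regular_in S d \<and> d * q = b)"

definition right_submodule :: "'q::ring_1 set \<Rightarrow> 'q set \<Rightarrow> bool" where
  "right_submodule S I \<longleftrightarrow> 0 \<in> I \<and> (\<forall>a\<in>I. \<forall>b\<in>I. a + b \<in> I) \<and> (\<forall>a\<in>I. \<forall>s\<in>S. a * s \<in> I)"

definition left_submodule :: "'q::ring_1 set \<Rightarrow> 'q set \<Rightarrow> bool" where
  "left_submodule S I \<longleftrightarrow> 0 \<in> I \<and> (\<forall>a\<in>I. \<forall>b\<in>I. a + b \<in> I) \<and> (\<forall>a\<in>I. \<forall>s\<in>S. s * a \<in> I)"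

definition right_ideal_of :: "'q::ring_1 set \<Rightarrow> 'q set \<Rightarrow> bool" where
  "right_ideal_of S I \<longleftrightarrow> right_submodule S I \<and> I \<subseteq> S"

definition left_ideal_of :: "'q::ring_1 set \<Rightarrow> 'q set \<Rightarrow> bool" where
  "left_ideal_of S I \<longleftrightarrow> left_submodule S I \<and> I \<subseteq> S"

definition prime_ring :: "'q::ring_1 set \<Rightarrow> bool" where
  "prime_ring S \<longleftrightarrow> is_subring S \<and> S \<noteq> {0} \<and>
     (\<forall>a\<in>S. \<forall>b\<in>S. (\<forall>s\<in>S. a * s * b = 0) \<longrightarrow> a = 0 \<or> b = 0)"

definition right_annihilator :: "'q::ring_1 set \<Rightarrow> 'q set \<Rightarrow> 'q set" where
  "right_annihilator S X = {s \<in> S. \<forall>a\<in>X. a * s = 0}"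

definition left_annihilator :: "'q::ring_1 set \<Rightarrow> 'q set \<Rightarrow> 'q set" where
  "left_annihilator S X = {s \<in> S. \<forall>a\<in>X. s * a = 0}"

definition acc :: "'q set set \<Rightarrow> bool" where
  "acc \<A> \<longleftrightarrow>
     (\<forall>A :: nat \<Rightarrow> 'q set. (\<forall>n. A n \<in> \<A> \<and> A n \<subseteq> A (Suc n)) \<longrightarrow> (\<exists>n. \<forall>m\<ge>n. A m = A n))"

text \<open>The sum of the \<open>I n\<close> is direct.\<close>

definition independent_family :: "(nat \<Rightarrow> 'q::ring_1 set) \<Rightarrow> bool" where
  "independent_family I \<longleftrightarrow>
     (\<forall>N a. (\<forall>n<N. a n \<in> I n) \<and> (\<Sum>n<N. a n) = 0 \<longrightarrow> (\<forall>n<N. a n = 0))"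

definition right_goldie :: "'q::ring_1 set \<Rightarrow> bool" where
  "right_goldie S \<longleftrightarrow> acc {right_annihilator S X | X. X \<subseteq> S} \<and>
     \<not> (\<exists>I. (\<forall>n. right_ideal_of S (I n) \<and> I n \<noteq> {0}) \<and> independent_family I)"

definition left_goldie :: "'q::ring_1 set \<Rightarrow> bool" where
  "left_goldie S \<longleftrightarrow> acc {left_annihilator S X | X. X \<subseteq> S} \<and>
     \<not> (\<exists>I. (\<forall>n. left_ideal_of S (I n) \<and> I n \<noteq> {0}) \<and> independent_family I)"

text \<open>
  \<open>S\<close> is an order in the whole type \<open>'q\<close>, which is meant to be simple Artinian; it will be
  instantiated with a division ring.
\<close>

definition is_order :: "'q::ring_1 set \<Rightarrow> bool" where
  "is_order S \<longleftrightarrow> prime_ring S \<and> right_goldie S \<and> left_goldie S \<and> has_total_quotient_ring_UNIV S"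


subsection \<open>Bezout and \<open>\<nu>\<close>-Bezout orders\<close>

definition residual_l :: "'q::ring_1 set \<Rightarrow> 'q set \<Rightarrow> 'q set" where
  "residual_l A B = {q. \<forall>b\<in>B. q * b \<in> A}"

definition residual_r :: "'q::ring_1 set \<Rightarrow> 'q set \<Rightarrow> 'q set" where
  "residual_r A B = {q. \<forall>b\<in>B. b * q \<in> A}"

definition right_S_ideal :: "'q::ring_1 set \<Rightarrow> 'q set \<Rightarrow> bool" where
  "right_S_ideal S I \<longleftrightarrow> right_submodule S I \<and> (\<exists>c\<in>I. regular_in S c) \<and>
     (\<exists>u. unit_elem u \<and> (\<forall>a\<in>I. u * a \<in> S))"

definition left_S_ideal :: "'q::ring_1 set \<Rightarrow> 'q set \<Rightarrow> bool" where
  "left_S_ideal S J \<longleftrightarrow> left_submodule S J \<and> (\<exists>c\<in>J. regular_in S c) \<and>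
     (\<exists>u. unit_elem u \<and> (\<forall>a\<in>J. a * u \<in> S))"

definition right_nu :: "'q::ring_1 set \<Rightarrow> 'q set \<Rightarrow> 'q set" where
  "right_nu S I = residual_r S (residual_l S I)"

definition left_nu :: "'q::ring_1 set \<Rightarrow> 'q set \<Rightarrow> 'q set" where
  "left_nu S J = residual_l S (residual_r S J)"

definition fin_gen_right :: "'q::ring_1 set \<Rightarrow> 'q set \<Rightarrow> bool" where
  "fin_gen_right S I \<longleftrightarrow>
     (\<exists>F. finite F \<and> I = {\<Sum>g\<in>F. g * c g | c. \<forall>g\<in>F. c g \<in> S})"

definition fin_gen_left :: "'q::ring_1 set \<Rightarrow> 'q set \<Rightarrow> bool" where
  "fin_gen_left S I \<longleftrightarrow>
     (\<exists>F. finite F \<and> I = {\<Sum>g\<in>F. c g * g | c. \<forall>g\<in>F. c g \<in> S})"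

definition principal_right_ideal :: "'q::ring_1 set \<Rightarrow> 'q set \<Rightarrow> bool" where
  "principal_right_ideal S I \<longleftrightarrow> (\<exists>a\<in>S. I = {a * s | s. s \<in> S})"

definition principal_left_ideal :: "'q::ring_1 set \<Rightarrow> 'q set \<Rightarrow> bool" where
  "principal_left_ideal S I \<longleftrightarrow> (\<exists>a\<in>S. I = {s * a | s. s \<in> S})"

definition right_nu_bezout :: "'q::ring_1 set \<Rightarrow> bool" where
  "right_nu_bezout S \<longleftrightarrow>
     (\<forall>I. right_S_ideal S I \<and> I \<subseteq> S \<and> fin_gen_right S I \<longrightarrow> principal_right_ideal S (right_nu S I))"

definition left_nu_bezout :: "'q::ring_1 set \<Rightarrow> bool" where
  "left_nu_bezout S \<longleftrightarrow>
     (\<forall>J. left_S_ideal S J \<and> J \<subseteq> S \<and> fin_gen_left S J \<longrightarrow> principal_left_ideal S (left_nu S J))"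

definition nu_bezout_order :: "'q::ring_1 set \<Rightarrow> bool" where
  "nu_bezout_order S \<longleftrightarrow> is_order S \<and> right_nu_bezout S \<and> left_nu_bezout S"

definition bezout_order :: "'q::ring_1 set \<Rightarrow> bool" where
  "bezout_order S \<longleftrightarrow> is_order S \<and>
     (\<forall>I. right_ideal_of S I \<and> fin_gen_right S I \<and> (\<exists>c\<in>I. regular_in S c)
        \<longrightarrow> principal_right_ideal S I) \<and>
     (\<forall>J. left_ideal_of S J \<and> fin_gen_left S J \<and> (\<exists>c\<in>J. regular_in S c)
        \<longrightarrow> principal_left_ideal S J)"


subsection \<open>The quotient division ring \<open>K(x,\<sigma>)\<close>\<close>

text \<open>
  A division ring \<open>'q\<close> together with an embedding \<open>\<iota>\<close> of \<open>K[x,\<sigma>]\<close> is a model of \<open>K(x,\<sigma>)\<close>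
  if \<open>\<iota>\<close> is an injective unital ring homomorphism and \<open>'q\<close> is the total quotient ring of its image.
  This determines \<open>('q, \<iota>)\<close> up to unique isomorphism. The identity of \<open>K[x,\<sigma>]\<close> is the
  constant polynomial \<open>[:1:]\<close>; \<^typ>\<open>'a poly\<close> has no \<open>1\<close> of its own unless \<open>'a\<close> is commutative.
\<close>

definition skew_quotient_division_ring ::
  "('a::division_ring \<Rightarrow> 'a) \<Rightarrow> ('a poly \<Rightarrow> 'q::division_ring) \<Rightarrow> bool" where
  "skew_quotient_division_ring \<sigma> \<iota> \<longleftrightarrow>
     inj \<iota> \<and> \<iota> [:1:] = 1 \<and>
     (\<forall>p q. \<iota> (p + q) = \<iota> p + \<iota> q) \<and>
     (\<forall>p q. \<iota> (skew_times \<sigma> p q) = \<iota> p * \<iota> q) \<and>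
     has_total_quotient_ring_UNIV (range \<iota>)"

end

(*
  Write P = K[x,\<sigma>], R = V + W[x,\<sigma>]x and X = Px = xP.

  If W = K, then P is a principal right ideal domain by Euclidean division, X is an ideal of P
  contained in R, and R/X = V. Given a, b in R, write a = d a', b = d b' with a' u + b' v = 1 in P.
  Then a'R + b'R contains a'X + b'X, hence X, so it is determined by the constant terms of a' and b';
  these generate the right V-module cV, where c is one of the two because V is a total valuation
  ring. Hence aR + bR = dcR.

  If W differs from K, choose w nonzero in W with w not invertible in W. Then Ww lies in V, so the
  left residual of I = wR + xR contains W[x,\<sigma>]. If I_\<nu> = dR, then w in dR forces d to be a constant,
  x in dR forces d to be a unit of W, and W[x,\<sigma>] d contained in R gives W = Wd contained in V.
*)

theory Submission
  imports Defs
begin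

section \<open>Principal one-sided ideals\<close>

text \<open>
  The multiplication is a parameter so that every result can also be applied to the opposite ring.
\<close>

locale mul_ring =
  fixes mul :: "'p::ab_group_add \<Rightarrow> 'p \<Rightarrow> 'p"  (infixl "\<odot>" 70)
    and e :: 'p
  assumes mul_assoc: "(a \<odot> b) \<odot> c = a \<odot> (b \<odot> c)"
    and add_mul: "(a + b) \<odot> c = a \<odot> c + b \<odot> c"
    and mul_add: "a \<odot> (b + c) = a \<odot> b + a \<odot> c"
    and e_mul [simp]: "e \<odot> a = a"
    and mul_e [simp]: "a \<odot> e = a"
begin

lemma mul_zero [simp]: "a \<odot> 0 = 0" and zero_mul [simp]: "0 \<odot> a = 0"
  using mul_add[of a 0 0] add_mul[of 0 0 a] by simp_all

lemma mul_minus: "a \<odot> (- b) = - (a \<odot> b)"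
  using mul_add[of a b "- b"] by (simp add: eq_neg_iff_add_eq_0 add.commute)

lemma mul_diff: "a \<odot> (b - c) = a \<odot> b - a \<odot> c"
  using mul_add[of a b "- c"] by (simp add: mul_minus)

section \<open>Euclidean division and greatest common left divisors\<close>

lemma euclidean_division:
  fixes deg :: "'p \<Rightarrow> nat"
  assumes reduce: "\<And>a b. \<lbrakk>a \<noteq> 0; b \<noteq> 0; deg b \<le> deg a\<rbrakk> \<Longrightarrow>
      \<exists>t. a - b \<odot> t = 0 \<or> deg (a - b \<odot> t) < deg a"
    and "b \<noteq> 0"
  shows "\<exists>q r. a = b \<odot> q + r \<and> (r = 0 \<or> deg r < deg b)"
proof (induction "deg a" arbitrary: a rule: less_induct)
  case less
  show ?case
  proof (cases "a = 0 \<or> deg a < deg b")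
    case True
    then show ?thesis by (intro exI[of _ 0] exI[of _ a]) auto
  next
    case False
    \<comment> \<open>One cancellation step either ends with remainder 0 or lowers the degree. Zero
      is kept as a separate alternative because \<open>deg\<close> is unconstrained there.\<close>
    then obtain t where t: "a - b \<odot> t = 0 \<or> deg (a - b \<odot> t) < deg a"
      using reduce[of a b] \<open>b \<noteq> 0\<close> by auto
    then obtain q r where "a - b \<odot> t = b \<odot> q + r" and r: "r = 0 \<or> deg r < deg b"
      using less by (metis add.right_neutral mul_zero)
    then have "a = b \<odot> (t + q) + r" by (simp add: mul_add algebra_simps)
    then show ?thesis using r by blast
  qed
qed

text \<open>Euclid's algorithm, carrying cofactors along. The Bezout identity is stated for the
  cofactors rather than for \<open>d\<close>: multiplying it by \<open>d\<close> on the left gives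
  \<open>d\<close> as a combination of \<open>a\<close> and \<open>b\<close>, and it remains
  informative when \<open>a\<close> and \<open>b\<close> are both 0.\<close>

lemma euclidean_gcd:
  fixes deg :: "'p \<Rightarrow> nat"
  assumes reduce: "\<And>a b. \<lbrakk>a \<noteq> 0; b \<noteq> 0; deg b \<le> deg a\<rbrakk> \<Longrightarrow>
      \<exists>t. a - b \<odot> t = 0 \<or> deg (a - b \<odot> t) < deg a"
  shows "\<exists>d a' b' u v. a = d \<odot> a' \<and> b = d \<odot> b' \<and> a' \<odot> u + b' \<odot> v = e"
\<comment> \<open>The measure puts 0 strictly below every nonzero element; for polynomials the
  degree alone would not separate 0 from the nonzero constants.\<close>
proof (induction "if b = 0 then 0 else Suc (deg b)" arbitrary: a b rule: less_induct)
  case less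
  show ?case
  proof (cases "b = 0")
    case True
    then have "a = a \<odot> e \<and> b = a \<odot> 0 \<and> e \<odot> e + 0 \<odot> 0 = e" by simp
    then show ?thesis by blast
  next
    case False
    then obtain q r where a: "a = b \<odot> q + r" and r: "r = 0 \<or> deg r < deg b"
      using euclidean_division[OF reduce] by blast
    have "(if r = 0 then 0 else Suc (deg r)) < (if b = 0 then 0 else Suc (deg b))"
      using r False by auto
    from less[OF this] obtain d b' r' u v
      where d: "b = d \<odot> b'" "r = d \<odot> r'" "b' \<odot> u + r' \<odot> v = e" by blast
    have "a = d \<odot> (b' \<odot> q + r')" using a d by (simp add: mul_add mul_assoc)
    \<comment> \<open>Back substitution: \<open>r'\<close> is the new cofactor of \<open>a\<close>
      minus \<open>b' \<odot> q\<close>.\<close>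
    moreover have "(b' \<odot> q + r') \<odot> v + b' \<odot> (u - q \<odot> v) = e"
      using d(3) by (simp add: mul_diff add_mul mul_assoc algebra_simps)
    ultimately show ?thesis using d(1) by blast
  qed
qed

text \<open>In terms of ideals, aR + bR = dR: the first two equations give one inclusion, the third
  the other. Being equations between elements, they can be transported along an injective
  homomorphism by rewriting.\<close>

definition principal_pairs :: "'p set \<Rightarrow> bool" where
  "principal_pairs R \<longleftrightarrow> (\<forall>a\<in>R. \<forall>b\<in>R. \<exists>d\<in>R. \<exists>a'\<in>R. \<exists>b'\<in>R. \<exists>u\<in>R. \<exists>v\<in>R.
     a = d \<odot> a' \<and> b = d \<odot> b' \<and> d = a \<odot> u + b \<odot> v)"

text \<open>
  In the application \<open>X\<close> consists of the polynomials without constant term, and the element \<open>c\<close>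
  of the last assumption is the constant term of \<open>a\<close> or of \<open>b\<close>.
\<close>

lemma principal_pairsI:
  assumes e: "e \<in> R" "e \<notin> X"
    and R: "\<And>a b. \<lbrakk>a \<in> R; b \<in> R\<rbrakk> \<Longrightarrow> a - b \<in> R" "\<And>a b. \<lbrakk>a \<in> R; b \<in> R\<rbrakk> \<Longrightarrow> a \<odot> b \<in> R"
    and X: "X \<subseteq> R" "\<And>a b. \<lbrakk>a \<in> X; b \<in> X\<rbrakk> \<Longrightarrow> a + b \<in> X"
      "\<And>a y. y \<in> X \<Longrightarrow> a \<odot> y \<in> X" "\<And>a y. y \<in> X \<Longrightarrow> y \<odot> a \<in> X"
    and gcd: "\<And>a b. \<exists>d a' b' u v. a = d \<odot> a' \<and> b = d \<odot> b' \<and> a' \<odot> u + b' \<odot> v = e"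
    and val: "\<And>a b. a \<notin> X \<or> b \<notin> X \<Longrightarrow>
      \<exists>c. \<exists>r\<in>R. \<exists>s\<in>R. a = c \<odot> r \<and> b = c \<odot> s \<and> (a - c \<in> X \<or> b - c \<in> X)"
  shows "principal_pairs R"
  unfolding principal_pairs_def
proof (intro ballI)
  fix a b assume ab: "a \<in> R" "b \<in> R"
  obtain d a' b' u v where d: "a = d \<odot> a'" "b = d \<odot> b'" "a' \<odot> u + b' \<odot> v = e"
    using gcd by blast
  \<comment> \<open>Otherwise the Bezout identity would put \<open>e\<close> into the ideal
    \<open>X\<close>.\<close>
  have "a' \<notin> X \<or> b' \<notin> X" using d(3) X e(2) by metis
  from val[OF this] obtain c r s where rs: "r \<in> R" "s \<in> R" "a' = c \<odot> r" "b' = c \<odot> s"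
    and c: "a' - c \<in> X \<or> b' - c \<in> X" by blast
  have zR: "0 \<in> R" using R(1)[OF e(1) e(1)] by simp
  \<comment> \<open>For \<open>y\<close> in \<open>X\<close> the coefficients
    \<open>u \<odot> y\<close> and \<open>v \<odot> y\<close> lie in \<open>X\<close>, hence in
    \<open>R\<close>, even if \<open>u\<close> and \<open>v\<close> do not. So \<open>X\<close> is
    contained in a'R + b'R, and with it \<open>c\<close>, which differs from \<open>a'\<close> or
    \<open>b'\<close> by an element of \<open>X\<close>.\<close>
  have *: "y = a' \<odot> (u \<odot> y) + b' \<odot> (v \<odot> y)" for y
    using d(3) by (metis add_mul mul_assoc e_mul)
  have "\<exists>p\<in>R. \<exists>q\<in>R. c = a' \<odot> p + b' \<odot> q"
    using c
  proof
    assume y: "a' - c \<in> X"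
    let ?y = "a' - c"
    have mem: "u \<odot> ?y \<in> R" "v \<odot> ?y \<in> R" using X y by blast+
    have "c = a' - ?y" by simp
    also have "\<dots> = a' - (a' \<odot> (u \<odot> ?y) + b' \<odot> (v \<odot> ?y))" by (simp only: *[of ?y, symmetric])
    also have "\<dots> = a' \<odot> (e - u \<odot> ?y) + b' \<odot> (0 - v \<odot> ?y)"
      by (simp only: mul_diff[of _ e] mul_diff[of _ 0] mul_e mul_zero) simp
    finally show ?thesis using R(1)[OF e(1) mem(1)] R(1)[OF zR mem(2)] by blast
  next
    assume y: "b' - c \<in> X"
    let ?y = "b' - c"
    have mem: "u \<odot> ?y \<in> R" "v \<odot> ?y \<in> R" using X y by blast+
    have "c = b' - ?y" by simp
    also have "\<dots> = b' - (a' \<odot> (u \<odot> ?y) + b' \<odot> (v \<odot> ?y))" by (simp only: *[of ?y, symmetric])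
    also have "\<dots> = a' \<odot> (0 - u \<odot> ?y) + b' \<odot> (e - v \<odot> ?y)"
      by (simp only: mul_diff[of _ e] mul_diff[of _ 0] mul_e mul_zero) simp
    finally show ?thesis using R(1)[OF e(1) mem(2)] R(1)[OF zR mem(1)] by blast
  qed
  then obtain p q where pq: "p \<in> R" "q \<in> R" "c = a' \<odot> p + b' \<odot> q" by blast
  have dc: "d \<odot> c = a \<odot> p + b \<odot> q" using pq(3) d by (simp add: mul_add mul_assoc)
  have add: "g + h \<in> R" if "g \<in> R" "h \<in> R" for g h
    using R(1)[OF that(1) R(1)[OF zR that(2)]] by simp
  \<comment> \<open>The gcd \<open>d\<close> may lie outside \<open>R\<close>; the generator
    \<open>d \<odot> c\<close> is in \<open>R\<close> as a combination of \<open>a\<close> and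
    \<open>b\<close>.\<close>
  have "d \<odot> c \<in> R" unfolding dc using add R(2) ab pq by blast
  moreover have "a = d \<odot> c \<odot> r" "b = d \<odot> c \<odot> s" using d rs by (simp_all add: mul_assoc)
  ultimately show "\<exists>d\<in>R. \<exists>a'\<in>R. \<exists>b'\<in>R. \<exists>u\<in>R. \<exists>v\<in>R.
      a = d \<odot> a' \<and> b = d \<odot> b' \<and> d = a \<odot> u + b \<odot> v"
    using rs pq dc by blast
qed

text \<open>Generators are absorbed one at a time: the generator \<open>b\<close> obtained for
  \<open>F\<close> and the new element \<open>g\<close> are replaced by the generator of their
  pair.\<close>

lemma finite_principal:
  assumes pairs: "principal_pairs R" and "finite F" "F \<subseteq> R" and zero: "0 \<in> R"
    and R: "\<And>a b. \<lbrakk>a \<in> R; b \<in> R\<rbrakk> \<Longrightarrow> a + b \<in> R" "\<And>a b. \<lbrakk>a \<in> R; b \<in> R\<rbrakk> \<Longrightarrow> a \<odot> b \<in> R"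
  shows "\<exists>d\<in>R. {\<Sum>g\<in>F. g \<odot> c g | c. \<forall>g\<in>F. c g \<in> R} = {d \<odot> s | s. s \<in> R}"
  using assms(2,3)
proof (induction F rule: finite_induct)
  case empty
  show ?case using zero by (intro bexI[of _ 0]) auto
next
  case (insert g F)
  let ?I = "\<lambda>F. {\<Sum>g\<in>F. g \<odot> c g | c. \<forall>g\<in>F. c g \<in> R}"
  obtain b where b: "b \<in> R" and IH: "?I F = {b \<odot> s | s. s \<in> R}"
    using insert by auto
  obtain d a' b' u v where d: "d \<in> R" "a' \<in> R" "b' \<in> R" "u \<in> R" "v \<in> R"
      "g = d \<odot> a'" "b = d \<odot> b'" "d = g \<odot> u + b \<odot> v"
    using pairs b insert.prems unfolding principal_pairs_def by (metis insert_subset)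
  have "?I (insert g F) = {d \<odot> s | s. s \<in> R}"
  proof (intro equalityI subsetI)
    fix z assume "z \<in> ?I (insert g F)"
    then obtain c where c: "\<forall>h\<in>insert g F. c h \<in> R" "z = g \<odot> c g + (\<Sum>h\<in>F. h \<odot> c h)"
      using insert by auto
    have "(\<Sum>h\<in>F. h \<odot> c h) \<in> ?I F" using c by auto
    then obtain s where s: "s \<in> R" "(\<Sum>h\<in>F. h \<odot> c h) = b \<odot> s" unfolding IH by blast
    have "z = d \<odot> (a' \<odot> c g + b' \<odot> s)" using c(2) s d(6,7) by (simp add: mul_add mul_assoc)
    then show "z \<in> {d \<odot> s | s. s \<in> R}" using R c s d by blast
  next
    fix z assume "z \<in> {d \<odot> s | s. s \<in> R}"
    then obtain s where s: "s \<in> R" "z = d \<odot> s" by blast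
    then have z: "z = g \<odot> (u \<odot> s) + b \<odot> (v \<odot> s)"
      using d(8) by (metis add_mul mul_assoc)
    have "b \<odot> (v \<odot> s) \<in> ?I F" unfolding IH using R s d by blast
    then obtain c where c: "\<forall>h\<in>F. c h \<in> R" "b \<odot> (v \<odot> s) = (\<Sum>h\<in>F. h \<odot> c h)" by auto
    let ?c = "c(g := u \<odot> s)"
    have "(\<Sum>h\<in>F. h \<odot> ?c h) = (\<Sum>h\<in>F. h \<odot> c h)"
      using insert.hyps by (intro sum.cong) auto
    then have "z = (\<Sum>h\<in>insert g F. h \<odot> ?c h)" using z c insert.hyps by simp
    moreover have "\<forall>h\<in>insert g F. ?c h \<in> R" using c(1) R(2)[OF d(4) s(1)] by simp
    ultimately show "z \<in> ?I (insert g F)" by (intro CollectI exI[of _ ?c] conjI)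
  qed
  then show ?case using d(1) by blast
qed

end

interpretation right: mul_ring "(*)" "1 :: 'q::ring_1"
  by unfold_locales (auto simp: algebra_simps)

interpretation left: mul_ring "\<lambda>a b. b * a" "1 :: 'q::ring_1"
  by unfold_locales (auto simp: algebra_simps)


section \<open>Orders in a division ring\<close>

lemma is_subringD:
  assumes "is_subring S"
  shows "0 \<in> S" "1 \<in> S" "a \<in> S \<Longrightarrow> - a \<in> S" "\<lbrakk>a \<in> S; b \<in> S\<rbrakk> \<Longrightarrow> a + b \<in> S"
    "\<lbrakk>a \<in> S; b \<in> S\<rbrakk> \<Longrightarrow> a - b \<in> S" "\<lbrakk>a \<in> S; b \<in> S\<rbrakk> \<Longrightarrow> a * b \<in> S"
proof -
  have one: "1 \<in> S" and diff: "\<And>a b. \<lbrakk>a \<in> S; b \<in> S\<rbrakk> \<Longrightarrow> a - b \<in> S"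
    and "\<And>a b. \<lbrakk>a \<in> S; b \<in> S\<rbrakk> \<Longrightarrow> a * b \<in> S"
    using assms by (auto simp: is_subring_def)
  then show "1 \<in> S" "\<lbrakk>a \<in> S; b \<in> S\<rbrakk> \<Longrightarrow> a - b \<in> S" "\<lbrakk>a \<in> S; b \<in> S\<rbrakk> \<Longrightarrow> a * b \<in> S"
    by blast+
  show zero: "0 \<in> S" using diff[OF one one] by simp
  show neg: "- a \<in> S" if "a \<in> S" for a using diff[OF zero that] by simp
  show "a + b \<in> S" if "a \<in> S" "b \<in> S" using diff[OF that(1) neg[OF that(2)]] by simp
qed

lemma regular_in_iff_nonzero:
  fixes S :: "'q::division_ring set"
  assumes "is_subring S"
  shows "regular_in S c \<longleftrightarrow> c \<in> S \<and> c \<noteq> 0"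
  using is_subringD(2)[OF assms] by (auto simp: regular_in_def)

lemma unit_elem_nonzero: "(c :: 'q::division_ring) \<noteq> 0 \<Longrightarrow> unit_elem c"
  unfolding unit_elem_def by (intro exI[of _ "inverse c"]) simp

text \<open>A chain with these two possible values changes at most once. Annihilators in a domain
  are of this kind.\<close>

lemma acc_zero_or_all:
  fixes S :: "'q::zero set"
  assumes "\<A> \<subseteq> {{0}, S}" and "0 \<in> S"
  shows "acc \<A>"
  unfolding acc_def
proof (intro allI impI)
  fix A :: "nat \<Rightarrow> 'q set"
  assume A: "\<forall>n. A n \<in> \<A> \<and> A n \<subseteq> A (Suc n)"
  then have vals: "A n = {0} \<or> A n = S" for n using assms(1) by blast
  have mono: "A n \<subseteq> A m" if "n \<le> m" for n m
    by (rule lift_Suc_mono_le[of A, OF _ that]) (use A in blast)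
  show "\<exists>n. \<forall>m\<ge>n. A m = A n"
  proof (cases "\<forall>n. A n = {0}")
    case False
    then obtain n where "A n \<noteq> {0}" by blast
    then have "A m = A n" if "n \<le> m" for m
      using vals[of n] vals[of m] mono[OF that] assms(2) that by auto
    then show ?thesis by blast
  qed simp
qed

lemma independent_familyD:
  assumes "independent_family I" "\<And>n. n < N \<Longrightarrow> a n \<in> I n" "(\<Sum>n<N. a n) = 0" "n < N"
  shows "a n = 0"
  using assms(1)[unfolded independent_family_def, rule_format, of N a n] assms(2-) by simp

text \<open>Inside a division ring there are no zero divisors, which settles primeness and the
  annihilators. The fractions supply common multiples, so two nonzero one-sided ideals on the same
  side always intersect nontrivially.\<close>

lemma is_orderI:
  fixes S :: "'q::division_ring set"
  assumes S: "is_subring S"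
    and right_fractions: "\<And>q. \<exists>a\<in>S. \<exists>c\<in>S. c \<noteq> 0 \<and> q * c = a"
    and left_fractions: "\<And>q. \<exists>b\<in>S. \<exists>d\<in>S. d \<noteq> 0 \<and> d * q = b"
  shows "is_order S"
  unfolding is_order_def
proof (intro conjI)
  note reg = regular_in_iff_nonzero[OF S]
  show "prime_ring S" unfolding prime_ring_def
  proof (intro conjI ballI impI)
    show "S \<noteq> {0}" using is_subringD(2)[OF S] by (metis singletonD zero_neq_one)
    fix a b assume "\<forall>s\<in>S. a * s * b = 0"
    then have "a * 1 * b = 0" using is_subringD(2)[OF S] by blast
    then show "a = 0 \<or> b = 0" by simp
  qed (rule S)
  show "has_total_quotient_ring_UNIV S"
    unfolding has_total_quotient_ring_UNIV_def reg
    using S right_fractions left_fractions unit_elem_nonzero by blast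
  show "right_goldie S" unfolding right_goldie_def
  proof (intro conjI notI)
    have "right_annihilator S Y \<in> {{0}, S}" for Y
      using is_subringD(1)[OF S] by (cases "Y \<subseteq> {0}") (auto simp: right_annihilator_def)
    then show "acc {right_annihilator S X | X. X \<subseteq> S}"
      using is_subringD(1)[OF S] by (intro acc_zero_or_all[of _ S]) blast+
    assume "\<exists>I. (\<forall>n. right_ideal_of S (I n) \<and> I n \<noteq> {0}) \<and> independent_family I"
    then obtain I where I: "\<And>n. right_ideal_of S (I n)" "\<And>n. I n \<noteq> {0}"
      and ind: "independent_family I" by blast
    have ne: "\<exists>a\<in>I n. a \<noteq> 0" for n
      using I(1)[of n] I(2)[of n] unfolding right_ideal_of_def right_submodule_def by blast
    obtain a b where ab: "a \<in> I 0" "a \<noteq> 0" "b \<in> I 1" "b \<noteq> 0" using ne by metis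
    \<comment> \<open>Writing \<open>inverse a * b\<close> as a right fraction yields the common
      right multiple \<open>a * c = b * d\<close>, nonzero since \<open>b\<close> and
      \<open>d\<close> are.\<close>
    obtain c d where cd: "c \<in> S" "d \<in> S" "d \<noteq> 0" "inverse a * b * d = c"
      using right_fractions by metis
    have eq: "a * c = b * d" using cd(4) ab(2) by (auto simp: mult.assoc[symmetric])
    \<comment> \<open>The relation ac - bd = 0 already violates independence of the first two
      ideals.\<close>
    let ?f = "\<lambda>n::nat. if n = 0 then a * c else b * (- d)"
    have "?f n \<in> I n" if "n < 2" for n
    proof -
      have "n = 0 \<or> n = 1" using that by auto
      then show ?thesis
        using I(1)[of n] ab cd(1) is_subringD(3)[OF S cd(2)]
        unfolding right_ideal_of_def right_submodule_def
        by (auto simp del: mult_minus_right)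
    qed
    moreover have "(\<Sum>n<2. ?f n) = 0" using eq by (simp add: numeral_2_eq_2)
    ultimately have "?f 1 = 0"
      by (rule independent_familyD[OF ind, where N = 2 and a = ?f]) simp_all
    then show False using ab(4) cd(3) by simp
  qed
  show "left_goldie S" unfolding left_goldie_def
  proof (intro conjI notI)
    have "left_annihilator S Y \<in> {{0}, S}" for Y
      using is_subringD(1)[OF S] by (cases "Y \<subseteq> {0}") (auto simp: left_annihilator_def)
    then show "acc {left_annihilator S X | X. X \<subseteq> S}"
      using is_subringD(1)[OF S] by (intro acc_zero_or_all[of _ S]) blast+
    assume "\<exists>I. (\<forall>n. left_ideal_of S (I n) \<and> I n \<noteq> {0}) \<and> independent_family I"
    then obtain I where I: "\<And>n. left_ideal_of S (I n)" "\<And>n. I n \<noteq> {0}"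
      and ind: "independent_family I" by blast
    have ne: "\<exists>a\<in>I n. a \<noteq> 0" for n
      using I(1)[of n] I(2)[of n] unfolding left_ideal_of_def left_submodule_def by blast
    obtain a b where ab: "a \<in> I 0" "a \<noteq> 0" "b \<in> I 1" "b \<noteq> 0" using ne by metis
    \<comment> \<open>Mirror image: a left fraction for \<open>b * inverse a\<close> gives the
      common left multiple \<open>c * a = d * b\<close>.\<close>
    obtain c d where cd: "c \<in> S" "d \<in> S" "d \<noteq> 0" "d * (b * inverse a) = c"
      using left_fractions by metis
    have eq: "c * a = d * b" using cd(4) ab(2) by (auto simp: mult.assoc)
    let ?f = "\<lambda>n::nat. if n = 0 then c * a else (- d) * b"
    have "?f n \<in> I n" if "n < 2" for n
    proof -
      have "n = 0 \<or> n = 1" using that by auto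
      then show ?thesis
        using I(1)[of n] ab cd(1) is_subringD(3)[OF S cd(2)]
        unfolding left_ideal_of_def left_submodule_def
        by (auto simp del: mult_minus_left)
    qed
    moreover have "(\<Sum>n<2. ?f n) = 0" using eq by (simp add: numeral_2_eq_2)
    ultimately have "?f 1 = 0"
      by (rule independent_familyD[OF ind, where N = 2 and a = ?f]) simp_all
    then show False using ab(4) cd(3) by simp
  qed
qed

section \<open>From principal pairs to Bezout orders\<close>

lemma fin_gen_right_principal:
  assumes S: "is_subring S" and "right.principal_pairs S" "fin_gen_right S I" "I \<subseteq> S"
  shows "principal_right_ideal S I"
proof -
  obtain F where F: "finite F" "I = {\<Sum>g\<in>F. g * c g | c. \<forall>g\<in>F. c g \<in> S}"
    using assms by (auto simp: fin_gen_right_def)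
  \<comment> \<open>\<open>fin_gen_right\<close> admits generators from the whole division ring;
    indicator coefficients put them into \<open>I\<close>, hence into \<open>S\<close>.\<close>
  have "h \<in> I" if "h \<in> F" for h
  proof -
    have "h = (\<Sum>g\<in>F. g * (if g = h then 1 else 0))"
      using F(1) that by (simp add: if_distrib[of "\<lambda>t. _ * t"] cong: if_cong)
    then show ?thesis
      unfolding F(2) using is_subringD(1,2)[OF S]
      by (intro CollectI exI[of _ "\<lambda>g. if g = h then 1 else 0"]) simp
  qed
  then have "F \<subseteq> S" using assms(4) by blast
  then show ?thesis
    unfolding principal_right_ideal_def F(2)
    by (rule right.finite_principal[OF assms(2) F(1)]) (use is_subringD[OF S] in auto)
qed

lemma fin_gen_left_principal:
  assumes S: "is_subring S" and "left.principal_pairs S" "fin_gen_left S I" "I \<subseteq> S"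
  shows "principal_left_ideal S I"
proof -
  obtain F where F: "finite F" "I = {\<Sum>g\<in>F. c g * g | c. \<forall>g\<in>F. c g \<in> S}"
    using assms by (auto simp: fin_gen_left_def)
  have "h \<in> I" if "h \<in> F" for h
  proof -
    have "h = (\<Sum>g\<in>F. (if g = h then 1 else 0) * g)"
      using F(1) that by (simp add: if_distrib[of "\<lambda>t. t * _"] cong: if_cong)
    then show ?thesis
      unfolding F(2) using is_subringD(1,2)[OF S]
      by (intro CollectI exI[of _ "\<lambda>g. if g = h then 1 else 0"]) simp
  qed
  then have "F \<subseteq> S" using assms(4) by blast
  then show ?thesis
    unfolding principal_left_ideal_def F(2)
    by (rule left.finite_principal[OF assms(2) F(1)]) (use is_subringD[OF S] in auto)
qed

lemma bezout_orderI:
  assumes "is_order S" "right.principal_pairs S" "left.principal_pairs S"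
  shows "bezout_order S"
proof -
  have S: "is_subring S" using assms(1) by (simp add: is_order_def prime_ring_def)
  show ?thesis
    unfolding bezout_order_def right_ideal_of_def left_ideal_of_def
    using assms(1) fin_gen_right_principal[OF S assms(2)] fin_gen_left_principal[OF S assms(3)]
    by simp
qed

section \<open>Bezout orders are \<nu>-Bezout\<close>

lemma subset_right_nu: "I \<subseteq> right_nu S I"
  by (auto simp: right_nu_def residual_l_def residual_r_def)

lemma subset_left_nu: "I \<subseteq> left_nu S I"
  by (auto simp: left_nu_def residual_l_def residual_r_def)

text \<open>A principal ideal aS with \<open>a\<close> nonzero equals its \<nu>-closure:
  \<open>inverse a\<close> lies in the left residual, so it maps every element of the closure into
  \<open>S\<close>. The left-hand case is symmetric.\<close>

lemma bezout_imp_nu_bezout: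
  fixes S :: "'q::division_ring set"
  assumes "bezout_order S"
  shows "nu_bezout_order S"
proof -
  have ord: "is_order S" using assms by (simp add: bezout_order_def)
  then have S: "is_subring S" by (simp add: is_order_def prime_ring_def)
  note reg = regular_in_iff_nonzero[OF S]
  have "principal_right_ideal S (right_nu S I)"
    if I: "right_S_ideal S I" "I \<subseteq> S" "fin_gen_right S I" for I
  proof -
    have pr: "principal_right_ideal S I"
      using assms I unfolding bezout_order_def right_ideal_of_def right_S_ideal_def by blast
    then obtain a where a: "a \<in> S" "I = {a * s | s. s \<in> S}"
      unfolding principal_right_ideal_def by blast
    have "a \<noteq> 0" using I(1) a(2) unfolding right_S_ideal_def reg by auto
    then have "inverse a \<in> residual_l S I"
      unfolding residual_l_def a(2) by (auto simp: mult.assoc[symmetric])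
    then have "inverse a * q \<in> S" if "q \<in> right_nu S I" for q
      using that by (simp add: right_nu_def residual_r_def)
    moreover have "q = a * (inverse a * q)" for q
      using \<open>a \<noteq> 0\<close> by (simp flip: mult.assoc)
    ultimately have "right_nu S I \<subseteq> I" unfolding a(2) by blast
    then show ?thesis using pr subset_right_nu[of I S] by simp
  qed
  moreover have "principal_left_ideal S (left_nu S I)"
    if I: "left_S_ideal S I" "I \<subseteq> S" "fin_gen_left S I" for I
  proof -
    have pr: "principal_left_ideal S I"
      using assms I unfolding bezout_order_def left_ideal_of_def left_S_ideal_def by blast
    then obtain a where a: "a \<in> S" "I = {s * a | s. s \<in> S}"
      unfolding principal_left_ideal_def by blast
    have "a \<noteq> 0" using I(1) a(2) unfolding left_S_ideal_def reg by auto
    then have "inverse a \<in> residual_r S I"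
      unfolding residual_r_def a(2) by (auto simp: mult.assoc)
    then have "q * inverse a \<in> S" if "q \<in> left_nu S I" for q
      using that by (simp add: left_nu_def residual_l_def)
    moreover have "q = (q * inverse a) * a" for q
      using \<open>a \<noteq> 0\<close> by (simp add: mult.assoc)
    ultimately have "left_nu S I \<subseteq> I" unfolding a(2) by blast
    then show ?thesis using pr subset_left_nu[of I S] by simp
  qed
  ultimately show ?thesis
    using ord unfolding nu_bezout_order_def right_nu_bezout_def left_nu_bezout_def by blast
qed


section \<open>Skew polynomials\<close>

lemma degree_less_cancel:
  fixes a b :: "'a::ab_group_add poly"
  assumes "degree b \<le> degree a" "coeff b (degree a) = coeff a (degree a)"
  shows "a - b = 0 \<or> degree (a - b) < degree a"
proof -
  have "degree (a - b) \<le> degree a" using assms(1) by (simp add: degree_diff_le)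
  moreover have "degree (a - b) \<noteq> degree a" if "a - b \<noteq> 0"
    using assms(2) that leading_coeff_0_iff[of "a - b"] by auto
  ultimately show ?thesis by linarith
qed

locale skew_poly =
  fixes \<sigma> :: "'a::division_ring \<Rightarrow> 'a"
  assumes aut: "ring_automorphism_on UNIV \<sigma>"
begin

section \<open>Powers of \<sigma>, coefficients and degrees of skew products\<close>

lemma funpow_aut:
  "(\<sigma> ^^ n) (a * b) = (\<sigma> ^^ n) a * (\<sigma> ^^ n) b" "(\<sigma> ^^ n) 1 = 1" "(\<sigma> ^^ n) 0 = 0"
  "surj (\<sigma> ^^ n)" "(\<sigma> ^^ n) a = 0 \<longleftrightarrow> a = 0"
proof -
  have \<sigma>: "bij \<sigma>" "\<sigma> 1 = 1" "\<And>a b. \<sigma> (a + b) = \<sigma> a + \<sigma> b" "\<And>a b. \<sigma> (a * b) = \<sigma> a * \<sigma> b"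
    using aut by (auto simp: ring_automorphism_on_def)
  have "\<sigma> 0 = 0" using \<sigma>(3)[of 0 0] by simp
  then show zero: "(\<sigma> ^^ n) 0 = 0" by (induction n) auto
  show "(\<sigma> ^^ n) (a * b) = (\<sigma> ^^ n) a * (\<sigma> ^^ n) b" "(\<sigma> ^^ n) 1 = 1"
    using \<sigma> by (induction n) auto
  have bij: "bij (\<sigma> ^^ n)" by (rule bij_fn[OF \<sigma>(1)])
  then show "surj (\<sigma> ^^ n)" by (simp add: bij_is_surj)
  show "(\<sigma> ^^ n) a = 0 \<longleftrightarrow> a = 0" using zero bij by (metis bij_is_inj injD)
qed

lemma coeff_skew_times:
  "coeff (skew_times \<sigma> p q) n = (\<Sum>i\<le>n. coeff p i * (\<sigma> ^^ i) (coeff q (n - i)))"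
proof -
  let ?f = "\<lambda>i. if i \<le> n then coeff p i * (\<sigma> ^^ i) (coeff q (n - i)) else 0"
  have inner: "(\<Sum>j\<le>degree q. if i + j = n then coeff p i * (\<sigma> ^^ i) (coeff q j) else 0) = ?f i"
    for i
  proof (cases "i \<le> n")
    case True
    then have "(i + j = n) = (j = n - i)" for j by auto
    then show ?thesis using True by (simp add: sum.delta coeff_eq_0 funpow_aut)
  qed (auto intro!: sum.neutral)
  have "coeff (skew_times \<sigma> p q) n = (\<Sum>i\<le>degree p. ?f i)"
    unfolding skew_times_def by (simp add: coeff_sum inner)
  \<comment> \<open>Both index ranges embed in this one, and the added terms vanish: beyond
    \<open>degree p\<close> by the coefficient, beyond \<open>n\<close> by the definition of
    \<open>?f\<close>.\<close>
  also have "\<dots> = (\<Sum>i\<le>max (degree p) n. ?f i)"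
    by (rule sum.mono_neutral_left) (auto simp: coeff_eq_0)
  also have "\<dots> = (\<Sum>i\<le>n. ?f i)"
    by (rule sum.mono_neutral_right) auto
  finally show ?thesis by simp
qed

lemma coeff_skew_times_0 [simp]: "coeff (skew_times \<sigma> p q) 0 = coeff p 0 * coeff q 0"
  by (simp add: coeff_skew_times)

text \<open>Stated for upper bounds instead of exact degrees, so that it applies to a monomial
  whatever its coefficient.\<close>

lemma skew_times_degree_bound:
  assumes "degree p \<le> m" "degree q \<le> n"
  shows "degree (skew_times \<sigma> p q) \<le> m + n"
    "coeff (skew_times \<sigma> p q) (m + n) = coeff p m * (\<sigma> ^^ m) (coeff q n)"
proof -
  \<comment> \<open>Above total degree \<open>m + n\<close>, and in that degree away from
    \<open>i = m\<close>, one of the two coefficients is beyond its bound.\<close>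
  have z: "coeff p i * (\<sigma> ^^ i) (coeff q (k - i)) = 0"
    if "m + n < k \<or> k = m + n \<and> i \<noteq> m" "i \<le> k" for i k
  proof -
    have "m < i \<or> n < k - i" using that by auto
    then show ?thesis using assms by (auto simp: coeff_eq_0 funpow_aut)
  qed
  show "degree (skew_times \<sigma> p q) \<le> m + n"
    by (rule degree_le) (use z in \<open>auto simp: coeff_skew_times intro!: sum.neutral\<close>)
  have "coeff (skew_times \<sigma> p q) (m + n) =
      (\<Sum>i\<in>{m}. coeff p i * (\<sigma> ^^ i) (coeff q (m + n - i)))"
    unfolding coeff_skew_times
    by (rule sum.mono_neutral_right) (use z in auto)
  then show "coeff (skew_times \<sigma> p q) (m + n) = coeff p m * (\<sigma> ^^ m) (coeff q n)" by simp
qed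

text \<open>The top coefficient is a product of nonzero elements, since the powers of \<sigma> are
  injective.\<close>

lemma degree_skew_times:
  assumes "p \<noteq> 0" "q \<noteq> 0"
  shows "degree (skew_times \<sigma> p q) = degree p + degree q"
  using skew_times_degree_bound[of p "degree p" q "degree q"] assms
  by (intro antisym le_degree) (auto simp: funpow_aut)

lemma coeff_skew_times_const [simp]:
  "coeff (skew_times \<sigma> p [:a:]) n = coeff p n * (\<sigma> ^^ n) a"
  "coeff (skew_times \<sigma> [:a:] p) n = a * coeff p n"
proof -
  have "coeff (skew_times \<sigma> p [:a:]) n = (\<Sum>i\<in>{n}. coeff p i * (\<sigma> ^^ i) (coeff [:a:] (n - i)))"
    unfolding coeff_skew_times
    by (rule sum.mono_neutral_right) (auto simp: coeff_pCons funpow_aut split: nat.splits)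
  then show "coeff (skew_times \<sigma> p [:a:]) n = coeff p n * (\<sigma> ^^ n) a" by simp
  have "coeff (skew_times \<sigma> [:a:] p) n = (\<Sum>i\<in>{0}. coeff [:a:] i * (\<sigma> ^^ i) (coeff p (n - i)))"
    unfolding coeff_skew_times
    by (rule sum.mono_neutral_right) (auto simp: coeff_pCons split: nat.splits)
  then show "coeff (skew_times \<sigma> [:a:] p) n = a * coeff p n" by simp
qed

lemma skew_times_X: "skew_times \<sigma> p (monom 1 1) = pCons 0 p"
proof (rule poly_eqI)
  fix n
  show "coeff (skew_times \<sigma> p (monom 1 1)) n = coeff (pCons 0 p) n"
  proof (cases n)
    case (Suc m)
    have "coeff (skew_times \<sigma> p (monom 1 1)) n =
        (\<Sum>i\<in>{m}. coeff p i * (\<sigma> ^^ i) (coeff (monom 1 1) (n - i)))"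
      unfolding coeff_skew_times
      by (rule sum.mono_neutral_right) (auto simp: Suc funpow_aut)
    then show ?thesis by (simp add: Suc funpow_aut)
  qed simp
qed

section \<open>Cancellation of leading terms on either side\<close>

lemma reduce_right:
  assumes "b \<noteq> 0" "degree b \<le> degree a"
  shows "\<exists>t. a - skew_times \<sigma> b t = 0 \<or> degree (a - skew_times \<sigma> b t) < degree a"
proof -
  let ?m = "degree b" and ?k = "degree a - degree b"
  \<comment> \<open>Moving \<open>c\<close> past the leading power of x in \<open>b\<close> applies
    \<open>\<sigma> ^^ ?m\<close>, so cancelling the leading term requires a preimage.\<close>
  obtain c where c: "(\<sigma> ^^ ?m) c = inverse (lead_coeff b) * lead_coeff a"
    using funpow_aut(4)[of ?m] by (metis surjD)
  let ?t = "monom c ?k"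
  have "degree (skew_times \<sigma> b ?t) \<le> degree a"
    "coeff (skew_times \<sigma> b ?t) (degree a) = lead_coeff b * (\<sigma> ^^ ?m) c"
    using skew_times_degree_bound[of b ?m ?t ?k] assms(2) by (simp_all add: degree_monom_le)
  then have "a - skew_times \<sigma> b ?t = 0 \<or> degree (a - skew_times \<sigma> b ?t) < degree a"
    using assms(1) by (intro degree_less_cancel) (simp_all add: c mult.assoc[symmetric])
  then show ?thesis by blast
qed

lemma reduce_left:
  assumes "b \<noteq> 0" "degree b \<le> degree a"
  shows "\<exists>t. a - skew_times \<sigma> t b = 0 \<or> degree (a - skew_times \<sigma> t b) < degree a"
proof -
  let ?k = "degree a - degree b"
  \<comment> \<open>With the monomial on the left the twist falls on the leading coefficient of
    \<open>b\<close>, and the solution is explicit.\<close>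
  let ?c = "lead_coeff a * inverse ((\<sigma> ^^ ?k) (lead_coeff b))"
  let ?t = "monom ?c ?k"
  have "degree (skew_times \<sigma> ?t b) \<le> degree a"
    "coeff (skew_times \<sigma> ?t b) (degree a) = ?c * (\<sigma> ^^ ?k) (lead_coeff b)"
    using skew_times_degree_bound[of ?t ?k b "degree b"] assms(2) by (simp_all add: degree_monom_le)
  then have "a - skew_times \<sigma> ?t b = 0 \<or> degree (a - skew_times \<sigma> ?t b) < degree a"
    using assms(1) by (intro degree_less_cancel) (simp_all add: funpow_aut mult.assoc)
  then show ?thesis by blast
qed

end

section \<open>The embedding of K[x,\<sigma>] into its quotient division ring\<close>

locale skew_quotient = skew_poly \<sigma> for \<sigma> :: "'a::division_ring \<Rightarrow> 'a" +
  fixes \<iota> :: "'a poly \<Rightarrow> 'q::division_ring"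
  assumes quotient: "skew_quotient_division_ring \<sigma> \<iota>"
begin

lemma embedding:
  "\<iota> p = \<iota> q \<longleftrightarrow> p = q" "\<iota> [:1:] = 1" "\<iota> (p + q) = \<iota> p + \<iota> q"
  "\<iota> (skew_times \<sigma> p q) = \<iota> p * \<iota> q" "\<iota> 0 = 0" "\<iota> (p - q) = \<iota> p - \<iota> q"
proof -
  have *: "inj \<iota>" "\<iota> [:1:] = 1" "\<And>p q. \<iota> (p + q) = \<iota> p + \<iota> q"
    "\<And>p q. \<iota> (skew_times \<sigma> p q) = \<iota> p * \<iota> q"
    using quotient by (auto simp: skew_quotient_division_ring_def)
  then show "\<iota> p = \<iota> q \<longleftrightarrow> p = q" "\<iota> [:1:] = 1" "\<iota> (p + q) = \<iota> p + \<iota> q"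
    "\<iota> (skew_times \<sigma> p q) = \<iota> p * \<iota> q"
    by (auto dest: injD)
  show "\<iota> 0 = 0" using *(3)[of 0 0] by simp
  show "\<iota> (p - q) = \<iota> p - \<iota> q" using *(3)[of "p - q" q] by (simp add: algebra_simps)
qed

lemma embedding_eq_0_iff: "\<iota> p = 0 \<longleftrightarrow> p = 0"
  using embedding(1)[of p 0] embedding(5) by simp

text \<open>The ring laws of \<^term>\<open>skew_times \<sigma>\<close> are inherited from the quotient division ring.\<close>

sublocale Pr: mul_ring "skew_times \<sigma>" "[:1:]"
  by unfold_locales (simp_all add: embedding(2-4) algebra_simps flip: embedding(1))

sublocale Pl: mul_ring "\<lambda>p q. skew_times \<sigma> q p" "[:1:]"
  by unfold_locales (simp_all add: embedding(2-4) algebra_simps flip: embedding(1))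

lemma const_inverse: "a \<noteq> 0 \<Longrightarrow> skew_times \<sigma> [:a:] [:inverse a:] = [:1:]"
  by (rule poly_eqI) (auto simp: coeff_pCons split: nat.splits)

lemma const_factor:
  assumes "a \<noteq> 0"
  shows "skew_times \<sigma> [:a:] (skew_times \<sigma> [:inverse a:] p) = p"
    "skew_times \<sigma> (skew_times \<sigma> p [:inverse a:]) [:a:] = p"
  using const_inverse[of a] const_inverse[of "inverse a"] assms
  by (simp_all add: Pr.mul_assoc flip: Pr.mul_assoc[of "[:a:]"])

section \<open>Divisibility with respect to \<open>V\<close>\<close>

context
  fixes V :: "'a set"
  assumes val: "total_valuation_ring V"
begin

lemma V_subring: "is_subring V"
  using val by (simp add: total_valuation_ring_def)

text \<open>For nonzero arguments \<open>inverse a * b\<close> and \<open>inverse b * a\<close> are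
  inverse to each other, so one lies in \<open>V\<close>. Thus one of \<open>a\<close>,
  \<open>b\<close> generates the right V-module aV + bV; the primed version serves left
  modules.\<close>

lemma V_compare:
  assumes "a \<noteq> 0 \<or> b \<noteq> 0"
  obtains "a \<noteq> 0" "inverse a * b \<in> V" | "b \<noteq> 0" "inverse b * a \<in> V"
proof (cases "a = 0 \<or> b = 0")
  case False
  then have "inverse a * b \<in> V \<or> inverse (inverse a * b) \<in> V"
    using val by (auto simp: total_valuation_ring_def)
  then show ?thesis using that False by (auto simp: nonzero_inverse_mult_distrib)
qed (use that is_subringD(1)[OF V_subring] assms in auto)

lemma V_compare':
  assumes "a \<noteq> 0 \<or> b \<noteq> 0"
  obtains "a \<noteq> 0" "b * inverse a \<in> V" | "b \<noteq> 0" "a * inverse b \<in> V"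
proof (cases "a = 0 \<or> b = 0")
  case False
  then have "b * inverse a \<in> V \<or> inverse (b * inverse a) \<in> V"
    using val by (auto simp: total_valuation_ring_def)
  then show ?thesis using that False by (auto simp: nonzero_inverse_mult_distrib)
qed (use that is_subringD(1)[OF V_subring] assms in auto)

section \<open>The case W = K\<close>

lemma principal_pairs_right: "Pr.principal_pairs {p. coeff p 0 \<in> V}"
proof (rule Pr.principal_pairsI[where X = "{p. coeff p 0 = 0}"])
  fix a b :: "'a poly"
  show "\<exists>d a' b' u v. a = skew_times \<sigma> d a' \<and> b = skew_times \<sigma> d b' \<and>
      skew_times \<sigma> a' u + skew_times \<sigma> b' v = [:1:]"
    by (rule Pr.euclidean_gcd[where deg = degree]) (rule reduce_right)
  assume "a \<notin> {p. coeff p 0 = 0} \<or> b \<notin> {p. coeff p 0 = 0}"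
  then have "coeff a 0 \<noteq> 0 \<or> coeff b 0 \<noteq> 0" by simp
  then obtain c where c: "c \<noteq> 0" "inverse c * coeff a 0 \<in> V" "inverse c * coeff b 0 \<in> V"
    "c = coeff a 0 \<or> c = coeff b 0"
    by (rule V_compare) (use is_subringD(2)[OF V_subring] in \<open>auto intro: that\<close>)
  then show "\<exists>c. \<exists>r\<in>{p. coeff p 0 \<in> V}. \<exists>s\<in>{p. coeff p 0 \<in> V}.
      a = skew_times \<sigma> c r \<and> b = skew_times \<sigma> c s \<and>
      (a - c \<in> {p. coeff p 0 = 0} \<or> b - c \<in> {p. coeff p 0 = 0})"
    \<comment> \<open>The constant \<open>c\<close> is a unit of K[x,\<sigma>], so division by it is
      possible; the choice of \<open>c\<close> puts the constant terms of the quotients into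
      \<open>V\<close>.\<close>
    by (intro exI[of _ "[:c:]"] bexI[of _ "skew_times \<sigma> [:inverse c:] a"]
      bexI[of _ "skew_times \<sigma> [:inverse c:] b"]) (auto simp: const_factor)
qed (use is_subringD[OF V_subring] in auto)

lemma principal_pairs_left: "Pl.principal_pairs {p. coeff p 0 \<in> V}"
proof (rule Pl.principal_pairsI[where X = "{p. coeff p 0 = 0}"])
  fix a b :: "'a poly"
  show "\<exists>d a' b' u v. a = skew_times \<sigma> a' d \<and> b = skew_times \<sigma> b' d \<and>
      skew_times \<sigma> u a' + skew_times \<sigma> v b' = [:1:]"
    by (rule Pl.euclidean_gcd[where deg = degree]) (rule reduce_left)
  assume "a \<notin> {p. coeff p 0 = 0} \<or> b \<notin> {p. coeff p 0 = 0}"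
  then have "coeff a 0 \<noteq> 0 \<or> coeff b 0 \<noteq> 0" by simp
  then obtain c where c: "c \<noteq> 0" "coeff a 0 * inverse c \<in> V" "coeff b 0 * inverse c \<in> V"
    "c = coeff a 0 \<or> c = coeff b 0"
    by (rule V_compare') (use is_subringD(2)[OF V_subring] in \<open>auto intro: that\<close>)
  then show "\<exists>c. \<exists>r\<in>{p. coeff p 0 \<in> V}. \<exists>s\<in>{p. coeff p 0 \<in> V}.
      a = skew_times \<sigma> r c \<and> b = skew_times \<sigma> s c \<and>
      (a - c \<in> {p. coeff p 0 = 0} \<or> b - c \<in> {p. coeff p 0 = 0})"
    by (intro exI[of _ "[:c:]"] bexI[of _ "skew_times \<sigma> a [:inverse c:]"]
      bexI[of _ "skew_times \<sigma> b [:inverse c:]"]) (auto simp: const_factor)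
qed (use is_subringD[OF V_subring] in auto)

lemma bezout_order_full: "bezout_order (\<iota> ` {p. coeff p 0 \<in> V})"
proof (rule bezout_orderI)
  let ?R = "{p. coeff p 0 \<in> V}"
  have "is_subring (\<iota> ` ?R)"
    unfolding is_subring_def
  proof (intro conjI ballI)
    have "[:1:] \<in> ?R" using is_subringD(2)[OF V_subring] by simp
    then show "1 \<in> \<iota> ` ?R" using embedding(2) by (metis imageI)
    fix a b assume "a \<in> \<iota> ` ?R" "b \<in> \<iota> ` ?R"
    then obtain p q where pq: "p \<in> ?R" "q \<in> ?R" "a = \<iota> p" "b = \<iota> q" by blast
    then have "p - q \<in> ?R" "skew_times \<sigma> p q \<in> ?R"
      using is_subringD(5,6)[OF V_subring] by simp_all
    then show "a - b \<in> \<iota> ` ?R" "a * b \<in> \<iota> ` ?R"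
      unfolding pq(3,4) embedding(4,6)[symmetric] by blast+
  qed
  moreover have q: "has_total_quotient_ring_UNIV (range \<iota>)"
    using quotient by (simp add: skew_quotient_division_ring_def)
  then have "is_subring (range \<iota>)" by (simp add: has_total_quotient_ring_UNIV_def)
  note reg = regular_in_iff_nonzero[OF this]
  let ?x = "monom 1 1 :: 'a poly"
  text \<open>Multiplying by \<open>x\<close> moves numerator and denominator into \<open>V + K[x,\<sigma>]x\<close>.\<close>
  have x: "\<iota> ?x \<noteq> 0" by (simp add: embedding_eq_0_iff monom_eq_0_iff)
  have xR: "\<iota> p * \<iota> ?x \<in> \<iota> ` ?R" "\<iota> ?x * \<iota> p \<in> \<iota> ` ?R" for p
    using is_subringD(1)[OF V_subring] unfolding embedding(4)[symmetric] by auto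
  have "\<exists>a\<in>\<iota> ` ?R. \<exists>c\<in>\<iota> ` ?R. c \<noteq> 0 \<and> z * c = a" for z
  proof -
    obtain p r where "\<iota> r \<noteq> 0" "z * \<iota> r = \<iota> p"
      using q unfolding has_total_quotient_ring_UNIV_def reg by blast
    then have "z * (\<iota> r * \<iota> ?x) = \<iota> p * \<iota> ?x" "\<iota> r * \<iota> ?x \<noteq> 0"
      using x by (simp_all flip: mult.assoc)
    then show ?thesis using xR(1) by metis
  qed
  moreover have "\<exists>b\<in>\<iota> ` ?R. \<exists>d\<in>\<iota> ` ?R. d \<noteq> 0 \<and> d * z = b" for z
  proof -
    obtain p r where "\<iota> r \<noteq> 0" "\<iota> r * z = \<iota> p"
      using q unfolding has_total_quotient_ring_UNIV_def reg by blast
    then have "(\<iota> ?x * \<iota> r) * z = \<iota> ?x * \<iota> p" "\<iota> ?x * \<iota> r \<noteq> 0"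
      using x by (simp_all add: mult.assoc)
    then show ?thesis using xR(2) by metis
  qed
  ultimately show "is_order (\<iota> ` ?R)" by (rule is_orderI)
  \<comment> \<open>Every equation in the definition transfers through the injective homomorphism
    \<open>\<iota>\<close>.\<close>
  show "right.principal_pairs (\<iota> ` ?R)"
    using principal_pairs_right
    unfolding right.principal_pairs_def Pr.principal_pairs_def ball_simps bex_simps
      embedding(3,4)[symmetric] embedding(1) .
  show "left.principal_pairs (\<iota> ` ?R)"
    using principal_pairs_left
    unfolding left.principal_pairs_def Pl.principal_pairs_def ball_simps bex_simps
      embedding(3,4)[symmetric] embedding(1) .
qed

section \<open>The case W different from K\<close>

lemma nu_bezout_imp_full:
  assumes W: "is_subring W" "V \<subset> W" "\<sigma> ` W = W"
    and nu: "nu_bezout_order (\<iota> ` skew_polys_const_in V W)"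
  shows "W = UNIV"
proof (rule ccontr)
  assume "W \<noteq> UNIV"
  let ?R = "skew_polys_const_in V W"
  let ?S = "\<iota> ` ?R"
  have R_iff: "p \<in> ?R \<longleftrightarrow> (\<forall>i. coeff p i \<in> W) \<and> coeff p 0 \<in> V" for p
    by (simp add: skew_polys_const_in_def skew_polys_def)
  have S: "is_subring ?S"
    using nu by (simp add: nu_bezout_order_def is_order_def prime_ring_def)
  note reg = regular_in_iff_nonzero[OF S]
  have S_iff: "\<iota> p \<in> ?S \<longleftrightarrow> p \<in> ?R" for p
    using embedding(1) by (auto simp: image_iff)
  have W\<sigma>: "(\<sigma> ^^ n) a \<in> W" if "a \<in> W" for a n
    using that W(3) by (induction n) auto
  \<comment> \<open>Take the inverse of some \<open>a\<close> outside \<open>W\<close>: as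
    \<open>a\<close> is not in \<open>V\<close> either, its inverse is in \<open>V\<close>.\<close>
  obtain w where w: "w \<noteq> 0" "w \<in> V" "inverse w \<notin> W"
  proof -
    obtain a where a: "a \<notin> W" using \<open>W \<noteq> UNIV\<close> by blast
    then have "a \<noteq> 0" "a \<notin> V" using is_subringD(1)[OF W(1)] W(2) by auto
    then show ?thesis using that[of "inverse a"] val a
      by (auto simp: total_valuation_ring_def)
  qed
  have wW: "w \<in> W" using w W by blast
  \<comment> \<open>If \<open>a * w\<close> were outside \<open>V\<close>, its inverse would lie in
    \<open>V\<close> and so in \<open>W\<close>; multiplying by \<open>a\<close> on the right gives
    \<open>inverse w\<close> in \<open>W\<close>.\<close>
  have Ww: "a * w \<in> V" if "a \<in> W" for a
  proof (rule ccontr)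
    assume aw: "a * w \<notin> V"
    then have "a * w \<noteq> 0" using is_subringD(1)[OF V_subring] by metis
    then have nz: "a \<noteq> 0" and "inverse (a * w) \<in> V"
      using val aw unfolding total_valuation_ring_def by (force, blast)
    then have "inverse (a * w) * a \<in> W" using W that is_subringD(6)[OF W(1)] by blast
    then have "inverse w \<in> W" using nz w(1) by (simp add: nonzero_inverse_mult_distrib mult.assoc)
    then show False using w by simp
  qed
  let ?x = "monom 1 1 :: 'a poly"
  have wR: "[:w:] \<in> ?R" and xR: "?x \<in> ?R"
    using w wW is_subringD[OF W(1)] is_subringD(1)[OF V_subring]
    by (auto simp: R_iff coeff_pCons split: nat.splits)
  \<comment> \<open>Distinctness of the generators lets the sum over \<open>?F\<close> split into
    two terms with independent coefficients.\<close>
  have ne: "\<iota> [:w:] \<noteq> \<iota> ?x"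
    unfolding embedding(1) poly_eq_iff by (auto intro!: exI[of _ 1])
  let ?F = "{\<iota> [:w:], \<iota> ?x}"
  define I where "I = {\<Sum>g\<in>?F. g * c g | c. \<forall>g\<in>?F. c g \<in> ?S}"
  have I_eq: "I = {\<iota> [:w:] * s + \<iota> ?x * t | s t. s \<in> ?S \<and> t \<in> ?S}" (is "_ = ?I'")
  proof (intro equalityI subsetI)
    fix z assume "z \<in> I"
    then show "z \<in> ?I'" unfolding I_def using ne by auto
  next
    fix z assume "z \<in> ?I'"
    then obtain s t where st: "s \<in> ?S" "t \<in> ?S" "z = \<iota> [:w:] * s + \<iota> ?x * t" by blast
    then have "z = (\<Sum>g\<in>?F. g * (if g = \<iota> [:w:] then s else t))" using ne by auto
    then show "z \<in> I" unfolding I_def using st(1,2) by fastforce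
  qed
  have wxS: "\<iota> [:w:] \<in> ?S" "\<iota> ?x \<in> ?S" using wR xR by blast+
  have memI: "\<iota> [:w:] * s + \<iota> ?x * t \<in> I" if "s \<in> ?S" "t \<in> ?S" for s t
    unfolding I_eq using that by blast
  have wI: "\<iota> [:w:] \<in> I" and xI: "\<iota> ?x \<in> I" and zI: "0 \<in> I"
    using memI[of 1 0] memI[of 0 1] memI[of 0 0] is_subringD(1,2)[OF S] by simp_all
  have "right_submodule ?S I"
    unfolding right_submodule_def
  proof (intro conjI ballI)
    show "0 \<in> I" by (rule zI)
    fix y z assume "y \<in> I" "z \<in> I"
    then obtain s t s' t' where st: "s \<in> ?S" "t \<in> ?S" "s' \<in> ?S" "t' \<in> ?S"
      "y = \<iota> [:w:] * s + \<iota> ?x * t" "z = \<iota> [:w:] * s' + \<iota> ?x * t'"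
      unfolding I_eq by blast
    then have "y + z = \<iota> [:w:] * (s + s') + \<iota> ?x * (t + t')" by (simp add: algebra_simps)
    then show "y + z \<in> I"
      using memI[of "s + s'" "t + t'"] is_subringD(4)[OF S] st(1-4) by simp
  next
    fix y r assume "y \<in> I" and r: "r \<in> ?S"
    then obtain s t where st: "s \<in> ?S" "t \<in> ?S" "y = \<iota> [:w:] * s + \<iota> ?x * t"
      unfolding I_eq by blast
    then have "y * r = \<iota> [:w:] * (s * r) + \<iota> ?x * (t * r)" by (simp add: algebra_simps)
    then show "y * r \<in> I"
      using memI[of "s * r" "t * r"] is_subringD(6)[OF S] st(1,2) r by simp
  qed
  moreover have IS: "I \<subseteq> ?S"
  proof
    fix z assume "z \<in> I"
    then obtain s t where st: "s \<in> ?S" "t \<in> ?S" "z = \<iota> [:w:] * s + \<iota> ?x * t"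
      unfolding I_eq by blast
    show "z \<in> ?S"
      unfolding st(3) using is_subringD(4,6)[OF S] wxS st(1,2) by simp
  qed
  moreover have "regular_in ?S (\<iota> [:w:])"
    unfolding reg using w(1) wxS by (simp add: embedding_eq_0_iff)
  ultimately have "right_S_ideal ?S I"
    unfolding right_S_ideal_def using wI unit_elem_nonzero[of "1::'q"]
    by (intro conjI bexI[of _ "\<iota> [:w:]"] exI[of _ 1]) auto
  moreover have "fin_gen_right ?S I"
    unfolding fin_gen_right_def I_def by (intro exI[of _ ?F]) simp
  ultimately have "principal_right_ideal ?S (right_nu ?S I)"
    using nu IS unfolding nu_bezout_order_def right_nu_bezout_def by blast
  then obtain d where dR: "d \<in> ?R" and nu_eq: "right_nu ?S I = {\<iota> d * s | s. s \<in> ?S}"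
    unfolding principal_right_ideal_def by blast
  obtain s where s: "s \<in> ?R" "[:w:] = skew_times \<sigma> d s"
    using wI subset_right_nu[of I ?S] unfolding nu_eq
    by (auto simp: embedding(1) simp flip: embedding(4))
  obtain t where t: "t \<in> ?R" "?x = skew_times \<sigma> d t"
    using xI subset_right_nu[of I ?S] unfolding nu_eq
    by (auto simp: embedding(1) simp flip: embedding(4))
  have "d \<noteq> 0" "s \<noteq> 0" using s(2) w(1) Pr.zero_mul[of s] Pr.mul_zero[of d] by auto
  \<comment> \<open>Degrees add, and the product \<open>[:w:]\<close> has degree 0.\<close>
  then have "degree d = 0" using degree_skew_times[of d s] s(2)
    by (metis add_is_0 degree_pCons_0)
  then obtain \<delta> where \<delta>: "d = [:\<delta>:]" by (rule degree_eq_zeroE)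
  \<comment> \<open>Compare the coefficients of x in x = dt. The inverse of \<delta> is thus a
    coefficient of \<open>t\<close>, which lies in \<open>W\<close>.\<close>
  have one: "\<delta> * coeff t 1 = 1"
    using arg_cong[OF t(2), of "\<lambda>p. coeff p 1"] by (simp add: \<delta>)
  have t1: "coeff t 1 \<in> W" using t(1) by (simp add: R_iff)
  have inv: "coeff t 1 * \<delta> = 1"
    using one by (metis inverse_unique left_inverse mult_zero_left zero_neq_one)
  have "a \<in> V" if a: "a \<in> W" for a
  proof -
    \<comment> \<open>Chosen so that \<open>?b * \<delta> = a\<close>. It belongs to the left
      residual of \<open>I\<close>: \<open>?b * w\<close> is in \<open>V\<close> by
      \<open>Ww\<close>, and the product with x has constant term 0.\<close>
    let ?b = "a * coeff t 1"
    have b: "?b \<in> W" using is_subringD(6)[OF W(1) a t1] .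
    have "\<iota> [:?b:] \<in> residual_l ?S I"
      unfolding residual_l_def
    proof (intro CollectI ballI)
      fix z assume "z \<in> I"
      then obtain p q where pq: "p \<in> ?S" "q \<in> ?S" "z = \<iota> [:w:] * p + \<iota> ?x * q"
        unfolding I_eq by blast
      have "skew_times \<sigma> [:?b:] [:w:] \<in> ?R"
        using is_subringD[OF W(1)] b wW W\<sigma> Ww
        by (auto simp: R_iff coeff_pCons split: nat.splits)
      moreover have "skew_times \<sigma> [:?b:] ?x \<in> ?R"
        using is_subringD[OF W(1)] b is_subringD(1)[OF V_subring]
        by (auto simp: R_iff skew_times_X coeff_pCons split: nat.splits)
      ultimately have "\<iota> [:?b:] * \<iota> [:w:] \<in> ?S" "\<iota> [:?b:] * \<iota> ?x \<in> ?S"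
        by (simp_all only: S_iff flip: embedding(4))
      then show "\<iota> [:?b:] * z \<in> ?S"
        using pq is_subringD(4,6)[OF S] by (simp add: distrib_left flip: mult.assoc)
    qed
    \<comment> \<open>The generator of the \<nu>-closure is multiplied into \<open>S\<close> by
      every element of the residual; the constant term of this product is \<open>a\<close>.\<close>
    moreover have "\<iota> d \<in> right_nu ?S I"
      unfolding nu_eq using is_subringD(2)[OF S] by (metis (mono_tags, lifting) CollectI mult_1_right)
    ultimately have "\<iota> [:?b:] * \<iota> d \<in> ?S" by (simp add: right_nu_def residual_r_def)
    then have "skew_times \<sigma> [:?b:] d \<in> ?R" by (simp only: S_iff flip: embedding(4))
    then have "?b * \<delta> \<in> V" by (simp add: R_iff \<delta>)
    then show "a \<in> V" using inv by (simp only: mult.assoc mult_1_right)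
  qed
  then show False using W(2) by blast
qed

end

end

theorem theorem2p3:
  fixes V W :: "'a::division_ring set"
    and \<sigma> :: "'a \<Rightarrow> 'a"
    and \<iota> :: "'a poly \<Rightarrow> 'q::division_ring"
  assumes "total_valuation_ring V" and "V \<noteq> UNIV"
    and "ring_automorphism_on V \<sigma>"
    and "ring_automorphism_on UNIV \<sigma>"
    and "is_subring W" and "V \<subset> W"
    and "\<sigma> ` W = W"
    and "skew_quotient_division_ring \<sigma> \<iota>"
  shows "(nu_bezout_order (\<iota> ` skew_polys_const_in V W) \<longleftrightarrow> W = UNIV) \<and>
         (W = UNIV \<longleftrightarrow> bezout_order (\<iota> ` skew_polys_const_in V W))"
proof -
  interpret skew_quotient \<sigma> \<iota> by unfold_locales fact+
  \<comment> \<open>For \<open>W = UNIV\<close> only the condition on the constant term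
    remains.\<close>
  have "bezout_order (\<iota> ` skew_polys_const_in V W)" if "W = UNIV"
    using bezout_order_full[OF assms(1)] that
    by (simp add: skew_polys_const_in_def skew_polys_def)
  \<comment> \<open>The implications close into a cycle: \<nu>-Bezout gives W = K, which gives
    Bezout, which gives \<nu>-Bezout.\<close>
  then show ?thesis
    using nu_bezout_imp_full[OF assms(1) assms(5-7)] bezout_imp_nu_bezout by blast
qed

end
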